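(* Let $G$ be a connected graph of order $n$. Then $$h_p(G)\le n-mt^*(G)-d_{\ge3}^*(G)+2.$$
   Context: Graphs are finite, undirected and loopless (multiple edges are allowed). The line graph $L(G)$ has vertex set $E(G)$, two vertices being adjacent if and only if the corresponding edges of $G$ share an endpoint; $L^0(G)=G$, $L^1(G)=L(G)$, $L^m(G)=L(L^{m-1}(G))$ (with $L^{m-1}(G)$ assumed to have a nonempty edge set). A graph is traceable if it has a hamiltonian path. The hamiltonian path index $h_p(G)$ is the minimum integer $m\ge 0$ such that $L^m(G)$ is traceable (so $h_p(G)=0$ if $G$ is traceable). $V_i(G)$ is the set of vertices of degree $i$ in $G$ and $\Delta(G)$ is the maximum degree. Let $MT^*(G)$ be a trail of $G$ (open or closed, possibly trivial; vertices may repeat, edges may not) which has the maximum number of (distinct) vertices among all trails of $G$ and, subject to this, contains the least number of vertices of $\bigcup_{i=3}^{\Delta(G)}V_i(G)$. Put $mt^*(G)=|V(MT^*(G))|$ and $d_{\ge3}^*(G)=\big|\bigcup_{i=3}^{\Delta(G)}V_i(G)\setminus V(MT^*(G))\big|$. *)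

theory Defs
  imports Main "HOL-Library.FSet"
begin

text \<open>Finite loopless undirected multigraphs. Edges are named, and \<open>ends\<close> sends an edge to its
  two-element set of endpoints, so distinct edges may have the same endpoints.\<close>

record ('v, 'e) mgraph =
  verts :: "'v set"
  edges :: "'e set"
  ends :: "'e \<Rightarrow> 'v set"

definition mgraph :: "('v, 'e) mgraph \<Rightarrow> bool" where
  "mgraph G \<longleftrightarrow> finite (verts G) \<and> finite (edges G) \<and>
     (\<forall>e\<in>edges G. ends G e \<subseteq> verts G \<and> card (ends G e) = 2)"

text \<open>A walk is given by the list of its vertices and the list of its edges, in order; a
  single vertex with no edge is a (trivial) walk.\<close>

definition walk :: "('v, 'e) mgraph \<Rightarrow> 'v list \<Rightarrow> 'e list \<Rightarrow> bool" where
  "walk G vs es \<longleftrightarrow> length vs = Suc (length es) \<and> set vs \<subseteq> verts G \<and> set es \<subseteq> edges G \<and>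
     (\<forall>i<length es. ends G (es ! i) = {vs ! i, vs ! Suc i})"

definition trail :: "('v, 'e) mgraph \<Rightarrow> 'v list \<Rightarrow> 'e list \<Rightarrow> bool" where
  "trail G vs es \<longleftrightarrow> walk G vs es \<and> distinct es"

definition path :: "('v, 'e) mgraph \<Rightarrow> 'v list \<Rightarrow> 'e list \<Rightarrow> bool" where
  "path G vs es \<longleftrightarrow> walk G vs es \<and> distinct vs"

definition connected :: "('v, 'e) mgraph \<Rightarrow> bool" where
  "connected G \<longleftrightarrow> verts G \<noteq> {} \<and>
     (\<forall>u\<in>verts G. \<forall>v\<in>verts G. \<exists>vs es. walk G vs es \<and> hd vs = u \<and> last vs = v)"

definition traceable :: "('v, 'e) mgraph \<Rightarrow> bool" where
  "traceable G \<longleftrightarrow> (\<exists>vs es. path G vs es \<and> set vs = verts G)"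

text \<open>Every edge counts once in the degree, since there are no loops.\<close>

definition degree :: "('v, 'e) mgraph \<Rightarrow> 'v \<Rightarrow> nat" where
  "degree G v = card {e \<in> edges G. v \<in> ends G e}"

definition max_degree :: "('v, 'e) mgraph \<Rightarrow> nat" where
  "max_degree G = Max (degree G ` verts G)"

definition verts_of_degree :: "('v, 'e) mgraph \<Rightarrow> nat \<Rightarrow> 'v set" where
  "verts_of_degree G i = {v \<in> verts G. degree G v = i}"

definition verts_ge3 :: "('v, 'e) mgraph \<Rightarrow> 'v set" where
  "verts_ge3 G = (\<Union>i\<in>{3..max_degree G}. verts_of_degree G i)"

text \<open>The graphs \<open>L\<^sup>m(G)\<close> for varying \<open>m\<close> must all live in one type. The objects below are the
  vertices and edges of \<open>G\<close>, closed under forming the edge \<open>Link {|e, f|}\<close> that joins \<open>e\<close> and \<open>f\<close>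
  in a line graph. Accordingly \<open>L\<^sup>0(G)\<close> is \<open>G\<close> with its vertices and edges tagged.\<close>

datatype ('v, 'e) obj = Vert 'v | Edge 'e | Link "('v, 'e) obj fset"

definition tag :: "('v, 'e) mgraph \<Rightarrow> (('v, 'e) obj, ('v, 'e) obj) mgraph" where
  "tag G = \<lparr>verts = Vert ` verts G, edges = Edge ` edges G,
     ends = (\<lambda>x. case x of Edge e \<Rightarrow> Vert ` ends G e | _ \<Rightarrow> {})\<rparr>"

definition line_graph ::
    "(('v, 'e) obj, ('v, 'e) obj) mgraph \<Rightarrow> (('v, 'e) obj, ('v, 'e) obj) mgraph" where
  "line_graph G = \<lparr>verts = edges G,
     edges = {Link {|e, f|} | e f. e \<in> edges G \<and> f \<in> edges G \<and> e \<noteq> f \<and> ends G e \<inter> ends G f \<noteq> {}},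
     ends = (\<lambda>x. case x of Link X \<Rightarrow> fset X | _ \<Rightarrow> {})\<rparr>"

definition iter_line_graph ::
    "nat \<Rightarrow> ('v, 'e) mgraph \<Rightarrow> (('v, 'e) obj, ('v, 'e) obj) mgraph" where
  "iter_line_graph m G = (line_graph ^^ m) (tag G)"

text \<open>If \<open>L\<^sup>m(G)\<close> has no edge then the graph returned for \<open>m + 1\<close> has no vertex; it is not
  traceable, because a path has at least one vertex. So only those \<open>m\<close> for which \<open>L\<^sup>m(G)\<close> is
  defined matter below.\<close>

definition ham_path_index :: "('v, 'e) mgraph \<Rightarrow> nat" where
  "ham_path_index G = (LEAST m. traceable (iter_line_graph m G))"

definition is_MT_star :: "('v, 'e) mgraph \<Rightarrow> 'v list \<Rightarrow> 'e list \<Rightarrow> bool" where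
  "is_MT_star G vs es \<longleftrightarrow> trail G vs es \<and>
     (\<forall>vs' es'. trail G vs' es' \<longrightarrow> card (set vs') \<le> card (set vs)) \<and>
     (\<forall>vs' es'. trail G vs' es' \<and> card (set vs') = card (set vs) \<longrightarrow>
        card (set vs \<inter> verts_ge3 G) \<le> card (set vs' \<inter> verts_ge3 G))"

lemma traceable_iter_line_graph_0:
  assumes "mgraph G"
  shows "traceable (iter_line_graph 0 G) \<longleftrightarrow> traceable G"
proof
  assume "traceable G"
  then obtain vs es where p: "walk G vs es" "distinct vs" "set vs = verts G"
    by (auto simp: traceable_def path_def)
  have "walk (tag G) (map Vert vs) (map Edge es)"
    using p(1) by (auto simp: walk_def tag_def)
  moreover have "distinct (map Vert vs)" "set (map Vert vs) = verts (tag G)"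
    using p by (auto simp: distinct_map inj_on_def tag_def)
  ultimately show "traceable (iter_line_graph 0 G)"
    unfolding traceable_def path_def iter_line_graph_def by auto
next
  assume "traceable (iter_line_graph 0 G)"
  then obtain vs es where p: "walk (tag G) vs es" "distinct vs" "set vs = Vert ` verts G"
    by (auto simp: traceable_def path_def iter_line_graph_def tag_def)
  have "vs \<in> lists (range Vert)" "es \<in> lists (range Edge)"
    using p by (auto simp: walk_def tag_def)
  then obtain vs' es' where [simp]: "vs = map Vert vs'" "es = map Edge es'"
    unfolding lists_image by auto
  have inj: "inj (Vert :: 'a \<Rightarrow> ('a, 'b) obj)" by (simp add: inj_def)
  have "walk G vs' es'"
    unfolding walk_def
  proof (intro conjI allI impI)
    fix i assume "i < length es'"
    then have "Vert ` ends G (es' ! i) = (Vert ` {vs' ! i, vs' ! Suc i} :: ('a, 'b) obj set)"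
      using p(1) by (auto simp: walk_def tag_def)
    then show "ends G (es' ! i) = {vs' ! i, vs' ! Suc i}"
      using inj_image_eq_iff[OF inj] by blast
  qed (use p in \<open>auto simp: walk_def tag_def\<close>)
  moreover have "distinct vs'" using p(2) by (simp add: distinct_map)
  moreover have "set vs' = verts G" using p(3) inj_image_eq_iff[OF inj] by auto
  ultimately show "traceable G" unfolding traceable_def path_def by blast
qed

lemma is_MT_star_exists:
  assumes "mgraph G" "verts G \<noteq> {}"
  shows "\<exists>vs es. is_MT_star G vs es"
proof -
  define P where "P p \<longleftrightarrow> trail G (fst p) (snd p)" for p :: "'a list \<times> 'b list"
  obtain v where "v \<in> verts G" using assms by auto
  then have ex: "P ([v], [])" by (simp add: P_def trail_def walk_def)
  have "card (set (fst p)) \<le> card (verts G)" if "P p" for p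
    using that assms by (auto simp: P_def trail_def walk_def mgraph_def intro!: card_mono)
  then have "\<exists>p. P p \<and> (\<forall>q. P q \<longrightarrow> card (set (fst q)) \<le> card (set (fst p)))"
    using ex_has_greatest_nat[of P "([v], [])" "\<lambda>p. card (set (fst p))" "Suc (card (verts G))"] ex
    by (auto simp: less_Suc_eq_le)
  then obtain p where p: "P p" "\<And>q. P q \<Longrightarrow> card (set (fst q)) \<le> card (set (fst p))" by blast
  define Q where "Q q \<longleftrightarrow> P q \<and> card (set (fst q)) = card (set (fst p))" for q
  have "Q p" using p by (simp add: Q_def)
  then obtain r where r: "Q r"
    "\<And>q. Q q \<Longrightarrow> card (set (fst r) \<inter> verts_ge3 G) \<le> card (set (fst q) \<inter> verts_ge3 G)"
    using ex_has_least_nat[of Q p "\<lambda>q. card (set (fst q) \<inter> verts_ge3 G)"] by blast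
  have "is_MT_star G (fst r) (snd r)"
    unfolding is_MT_star_def using p r unfolding Q_def P_def by auto
  then show ?thesis by blast
qed

end

theory Submission
  imports Defs
begin

text \<open>
  Cover \<open>G\<close> by edge-disjoint trails: the given trail and, for every vertex of degree at least 3
  outside it, the trivial closed trail at that vertex. Let \<open>U\<close> be the set of uncovered vertices, all
  of degree at most 2; it has \<open>n - mt\<^sup>* - d\<^sup>*\<close> elements. The edges that meet a (closed) trail can be
  ordered along it into a path (cycle) of \<open>L(G)\<close>, so \<open>L(G)\<close> has a cover of the same kind, whose
  uncovered vertices are the edges of \<open>G\<close> inside \<open>U\<close>. They again have degree at most 2 in \<open>L(G)\<close>, and
  if \<open>U \<noteq> {}\<close> there are fewer of them than elements of \<open>U\<close>, because \<open>G\<close> is connected. After at most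
  \<open>card U\<close> line graph steps nothing is uncovered. One step later the trails overlap so much that they
  merge into a single spanning trail, and the next line graph is traceable.
\<close>

section \<open>Trails as pairs of a vertex set and an edge set; connectedness by cuts\<close>

text \<open>Only the two end vertices and the sets of visited vertices and used edges are recorded.
  The order of the visits is forgotten, so cutting and splicing trails becomes a matter of unions
  and disjointness.\<close>

inductive trail_sets :: "('v, 'e) mgraph \<Rightarrow> 'v \<Rightarrow> 'v \<Rightarrow> 'v set \<Rightarrow> 'e set \<Rightarrow> bool" for G where
  trail_sets_Nil: "v \<in> verts G \<Longrightarrow> trail_sets G v v {v} {}"
| trail_sets_Cons: "trail_sets G v w X F \<Longrightarrow> e \<in> edges G \<Longrightarrow> e \<notin> F \<Longrightarrow> ends G e = {u, v} \<Longrightarrow> u \<in> verts G \<Longrightarrow>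
    trail_sets G u w (insert u X) (insert e F)"

definition incident :: "('v, 'e) mgraph \<Rightarrow> 'v set \<Rightarrow> 'e set" where
  "incident G X = {e \<in> edges G. ends G e \<inter> X \<noteq> {}}"

text \<open>Connectedness in terms of edge cuts: this form passes easily to the line graph, and it
  supplies the crossing edges on which the counting and merging arguments rest.\<close>

definition cut_connected :: "('v, 'e) mgraph \<Rightarrow> bool" where
  "cut_connected G \<longleftrightarrow> verts G \<noteq> {} \<and> (\<forall>S\<subseteq>verts G. S \<noteq> {} \<longrightarrow> S \<noteq> verts G \<longrightarrow>
     (\<exists>e\<in>edges G. ends G e \<inter> S \<noteq> {} \<and> ends G e - S \<noteq> {}))"

lemma walk_Cons:
  "walk G (v # w # vs) (e # es) \<longleftrightarrow>
     v \<in> verts G \<and> e \<in> edges G \<and> ends G e = {v, w} \<and> walk G (w # vs) es"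
  unfolding walk_def by (auto simp: nth_Cons split: nat.splits)

lemma walk_single: "walk G [v] es \<longleftrightarrow> es = [] \<and> v \<in> verts G"
  unfolding walk_def by auto

lemma walk_Nil: "\<not> walk G [] es"
  unfolding walk_def by auto

lemma trail_imp_trail_sets:
  "walk G vs es \<Longrightarrow> distinct es \<Longrightarrow> trail_sets G (hd vs) (last vs) (set vs) (set es)"
proof (induction es arbitrary: vs)
  case Nil
  then obtain v where "vs = [v]" by (auto simp: walk_def length_Suc_conv)
  with Nil show ?case by (auto simp: walk_single intro: trail_sets_Nil)
next
  case (Cons e es)
  then obtain v w vs' where vs: "vs = v # w # vs'"
    by (auto simp: walk_def length_Suc_conv)
  with Cons have "trail_sets G w (last vs) (set (w # vs')) (set es)"
    by (fastforce simp: walk_Cons)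
  then have "trail_sets G v (last vs) (insert v (set (w # vs'))) (insert e (set es))"
    using Cons.prems vs by (intro trail_sets_Cons) (auto simp: walk_Cons)
  then show ?case using vs by simp
qed

lemma walk_crosses:
  "walk G vs es \<Longrightarrow> hd vs \<in> S \<Longrightarrow> last vs \<notin> S \<Longrightarrow>
     \<exists>e\<in>edges G. ends G e \<inter> S \<noteq> {} \<and> ends G e - S \<noteq> {}"
proof (induction es arbitrary: vs)
  case Nil
  then obtain v where "vs = [v]" by (auto simp: walk_def length_Suc_conv)
  with Nil show ?case by auto
next
  case (Cons e es)
  then obtain v w vs' where vs: "vs = v # w # vs'"
    by (auto simp: walk_def length_Suc_conv)
  show ?case
  proof (cases "w \<in> S")
    case True
    with Cons vs show ?thesis by (fastforce simp: walk_Cons)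
  next
    case False
    with Cons.prems vs show ?thesis by (auto simp: walk_Cons intro!: bexI[of _ e])
  qed
qed

lemma connected_imp_cut_connected:
  assumes "connected G" shows "cut_connected G"
  unfolding cut_connected_def
proof (intro conjI allI impI)
  fix S assume S: "S \<subseteq> verts G" "S \<noteq> {}" "S \<noteq> verts G"
  then obtain u v where uv: "u \<in> S" "v \<in> verts G - S" by blast
  with S assms obtain vs es where "walk G vs es" "hd vs = u" "last vs = v"
    unfolding connected_def by blast
  with uv show "\<exists>e\<in>edges G. ends G e \<inter> S \<noteq> {} \<and> ends G e - S \<noteq> {}"
    by (intro walk_crosses) auto
qed (use assms in \<open>simp add: connected_def\<close>)

section \<open>Cutting and splicing trails\<close>

lemma trail_sets_props:
  assumes "trail_sets G u w X F"
  shows "u \<in> X" "X \<subseteq> verts G" "F \<subseteq> edges G" "\<And>e. e \<in> F \<Longrightarrow> ends G e \<subseteq> X"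
proof -
  have "u \<in> X \<and> X \<subseteq> verts G \<and> F \<subseteq> edges G \<and> (\<forall>e\<in>F. ends G e \<subseteq> X)"
    using assms by (induction rule: trail_sets.induct) auto
  then show "u \<in> X" "X \<subseteq> verts G" "F \<subseteq> edges G" "\<And>e. e \<in> F \<Longrightarrow> ends G e \<subseteq> X" by auto
qed

lemma trail_sets_append:
  assumes "trail_sets G u v X F" "trail_sets G v w Y H" "F \<inter> H = {}"
  shows "trail_sets G u w (X \<union> Y) (F \<union> H)"
  using assms
proof (induction rule: trail_sets.induct)
  case (trail_sets_Nil v)
  then show ?case using trail_sets_props(1)[OF trail_sets_Nil(2)] by (simp add: insert_absorb)
next
  case (trail_sets_Cons v w' X F e u)
  then show ?case using trail_sets.trail_sets_Cons[of G v w "X \<union> Y" "F \<union> H" e u] by simp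
qed

lemma trail_sets_split:
  assumes "trail_sets G u w X F" "x \<in> X"
  shows "\<exists>X1 F1 X2 F2. trail_sets G u x X1 F1 \<and> trail_sets G x w X2 F2 \<and> X = X1 \<union> X2 \<and> F = F1 \<union> F2 \<and> F1 \<inter> F2 = {}"
  using assms
proof (induction rule: trail_sets.induct)
  case (trail_sets_Nil v)
  then have "trail_sets G x x {x} {}" by (auto intro: trail_sets.trail_sets_Nil)
  then show ?case using trail_sets_Nil by fastforce
next
  case (trail_sets_Cons v w X F e u)
  show ?case
  proof (cases "x = u")
    case True
    have "trail_sets G u w (insert u X) (insert e F)" using trail_sets_Cons by (intro trail_sets.trail_sets_Cons)
    moreover have "trail_sets G u u {u} {}" using trail_sets_Cons by (intro trail_sets.trail_sets_Nil)
    ultimately show ?thesis using True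
      by (intro exI[of _ "{u}"] exI[of _ "{}"] exI[of _ "insert u X"] exI[of _ "insert e F"]) auto
  next
    case False
    with trail_sets_Cons obtain X1 F1 X2 F2 where *: "trail_sets G v x X1 F1" "trail_sets G x w X2 F2" "X = X1 \<union> X2"
      "F = F1 \<union> F2" "F1 \<inter> F2 = {}" by auto
    then have "trail_sets G u x (insert u X1) (insert e F1)" using trail_sets_Cons by (intro trail_sets.trail_sets_Cons[of G v]) auto
    then show ?thesis using * trail_sets_Cons
      by (intro exI[of _ "insert u X1"] exI[of _ "insert e F1"] exI[of _ X2] exI[of _ F2]) auto
  qed
qed

text \<open>Follow the first trail to a common vertex, go once round the closed trail, then continue
  on the first trail.\<close>

lemma trail_sets_join:
  assumes "trail_sets G u v X F" "trail_sets G w w Y H" "F \<inter> H = {}" "X \<inter> Y \<noteq> {}"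
  shows "trail_sets G u v (X \<union> Y) (F \<union> H)"
proof -
  obtain x where x: "x \<in> X" "x \<in> Y" using assms by auto
  obtain X1 F1 X2 F2 where 1: "trail_sets G u x X1 F1" "trail_sets G x v X2 F2" "X = X1 \<union> X2" "F = F1 \<union> F2" "F1 \<inter> F2 = {}"
    using trail_sets_split[OF assms(1) x(1)] by blast
  obtain Y1 H1 Y2 H2 where 2: "trail_sets G w x Y1 H1" "trail_sets G x w Y2 H2" "Y = Y1 \<union> Y2" "H = H1 \<union> H2" "H1 \<inter> H2 = {}"
    using trail_sets_split[OF assms(2) x(2)] by blast
  \<comment> \<open>Exchanging the two halves of the closed trail moves its base point from
    \<open>w\<close> to \<open>x\<close>.\<close>
  have "trail_sets G x x (Y2 \<union> Y1) (H2 \<union> H1)" using 2 by (intro trail_sets_append[of G x w]) auto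
  then have "trail_sets G u x (X1 \<union> (Y2 \<union> Y1)) (F1 \<union> (H2 \<union> H1))"
    using 1 2 assms(3) by (intro trail_sets_append) auto
  then have "trail_sets G u v (X1 \<union> (Y2 \<union> Y1) \<union> X2) (F1 \<union> (H2 \<union> H1) \<union> F2)"
    using 1 2 assms(3) by (intro trail_sets_append) auto
  moreover have "X1 \<union> (Y2 \<union> Y1) \<union> X2 = X \<union> Y" "F1 \<union> (H2 \<union> H1) \<union> F2 = F \<union> H" using 1 2 by auto
  ultimately show ?thesis by simp
qed

text \<open>The parallel edges form the closed trail from \<open>x\<close> to \<open>y\<close> and
  back. Spliced into the first trail, it reaches \<open>y\<close>, where the second trail can be
  spliced in.\<close>

lemma trail_sets_join_parallel:
  assumes "mgraph G" "trail_sets G u v X F" "trail_sets G w w Y H" "F \<inter> H = {}"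
    and "e \<in> edges G" "f \<in> edges G" "e \<noteq> f" "ends G e = {x, y}" "ends G f = {x, y}"
    and "x \<in> X" "y \<in> Y" "{e, f} \<inter> (F \<union> H) = {}"
  shows "trail_sets G u v (X \<union> Y) (F \<union> H \<union> {e, f})"
proof -
  have xy: "x \<in> verts G" "y \<in> verts G" using assms(1,5,8) by (auto simp: mgraph_def)
  have "trail_sets G y x (insert y {x}) (insert f {})"
    using assms xy by (intro trail_sets_Cons[OF trail_sets_Nil]) auto
  then have "trail_sets G x x (insert x {y, x}) (insert e {f})" using assms xy by (intro trail_sets_Cons) auto
  then have "trail_sets G x x {x, y} {e, f}" by (simp add: insert_commute)
  then have "trail_sets G u v (X \<union> {x, y}) (F \<union> {e, f})" using assms(10,12)
    by (intro trail_sets_join[OF assms(2), of x]) auto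
  then have "trail_sets G u v (X \<union> {x, y} \<union> Y) (F \<union> {e, f} \<union> H)"
    by (rule trail_sets_join[OF _ assms(3)]) (use assms(4,11,12) in auto)
  moreover have "X \<union> {x, y} \<union> Y = X \<union> Y" "F \<union> {e, f} \<union> H = F \<union> H \<union> {e, f}"
    using assms by auto
  ultimately show ?thesis by simp
qed

section \<open>Edges listed along a trail, and the trails they give in the line graph\<close>

lemma successively_if_all:
  "(\<And>x y. x \<in> set L \<Longrightarrow> y \<in> set L \<Longrightarrow> P x y) \<Longrightarrow> successively P L"
  by (induction P L rule: successively.induct) auto

text \<open>Insert the edges of \<open>Q\<close> that meet the trail at the first vertex where they meet it.\<close>

lemma trail_sets_imp_edge_list:
  assumes "trail_sets G u w X F" "finite Q" "Q \<inter> F = {}"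
  shows "\<exists>L. distinct L \<and> set L = F \<union> {e \<in> Q. ends G e \<inter> X \<noteq> {}} \<and>
    successively (\<lambda>e f. ends G e \<inter> ends G f \<inter> X \<noteq> {}) L \<and>
    (L \<noteq> [] \<longrightarrow> u \<in> ends G (hd L) \<and> w \<in> ends G (last L))"
  using assms
proof (induction arbitrary: Q rule: trail_sets.induct)
  case (trail_sets_Nil v)
  have "finite {e \<in> Q. v \<in> ends G e}" using trail_sets_Nil by simp
  then obtain L where L: "distinct L" "set L = {e \<in> Q. v \<in> ends G e}"
    by (metis finite_distinct_list)
  have "successively (\<lambda>e f. ends G e \<inter> ends G f \<inter> {v} \<noteq> {}) L"
    using L(2) by (intro successively_if_all) auto
  then show ?case using L hd_in_set[of L] last_in_set[of L] by (intro exI[of _ L]) auto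
next
  case (trail_sets_Cons v w X F e u)
  \<comment> \<open>The edges at the new first vertex \<open>u\<close> form a block placed before
    \<open>e\<close>; the induction hypothesis lists the remaining edges of
    \<open>Q\<close>.\<close>
  define R where "R = {f \<in> Q. u \<in> ends G f}"
  have "finite R" using trail_sets_Cons unfolding R_def by simp
  then obtain B where B: "distinct B" "set B = R" by (metis finite_distinct_list)
  obtain L where L: "distinct L" "set L = F \<union> {e \<in> Q - R. ends G e \<inter> X \<noteq> {}}"
    "successively (\<lambda>e f. ends G e \<inter> ends G f \<inter> X \<noteq> {}) L"
    "L \<noteq> [] \<longrightarrow> v \<in> ends G (hd L) \<and> w \<in> ends G (last L)"
    using trail_sets_Cons.IH[of "Q - R"] trail_sets_Cons.prems by (auto simp: R_def)
  have LX: "successively (\<lambda>e f. ends G e \<inter> ends G f \<inter> insert u X \<noteq> {}) L"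
    using L(3) by (rule successively_mono) auto
  have u: "u \<in> ends G f" if "f \<in> set B" for f using that B by (auto simp: R_def)
  have BX: "successively (\<lambda>e f. ends G e \<inter> ends G f \<inter> insert u X \<noteq> {}) B"
    using u by (intro successively_if_all) blast
  have vX: "v \<in> X" using trail_sets_Cons.hyps trail_sets_props by metis
  \<comment> \<open>If nothing follows \<open>e\<close> in the list, the rest of the trail is
    trivial, so \<open>e\<close> itself is the last edge and must contain \<open>w\<close>.\<close>
  have hw: "v = w" if "L = []"
  proof -
    have "F = {}" using that L by auto
    then show ?thesis using trail_sets_Cons.hyps(1) by (auto elim: trail_sets.cases)
  qed
  \<comment> \<open>Neighbours in this list share a vertex: the edges in \<open>B\<close> and
    \<open>e\<close> share \<open>u\<close>, and \<open>e\<close> and the head of \<open>L\<close>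
    share \<open>v\<close>.\<close>
  have "set (B @ e # L) = insert e F \<union> {f \<in> Q. ends G f \<inter> insert u X \<noteq> {}}"
    using B L by (auto simp: R_def)
  moreover have "distinct (B @ e # L)"
    using B L trail_sets_Cons.prems trail_sets_Cons.hyps by (auto simp: R_def)
  moreover have "successively (\<lambda>e f. ends G e \<inter> ends G f \<inter> insert u X \<noteq> {}) (B @ e # L)"
    using LX BX L(4) vX u[OF last_in_set[of B]] trail_sets_Cons.hyps(4)
    by (auto simp: successively_append_iff successively_Cons)
  moreover have "u \<in> ends G (hd (B @ e # L))"
    using u[of "hd B"] trail_sets_Cons.hyps by (cases B) auto
  moreover have "w \<in> ends G (last (B @ e # L))"
    using L(4) hw trail_sets_Cons.hyps by auto
  ultimately show ?case by blast
qed

text \<open>The edges of the line graph that are due to a vertex in \<open>X\<close>. The trail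
  built in the line graph from a trail through \<open>X\<close> uses only these, which is how
  different trails are kept edge-disjoint.\<close>

definition links_at :: "(('v, 'e) obj, ('v, 'e) obj) mgraph \<Rightarrow> ('v, 'e) obj set \<Rightarrow> ('v, 'e) obj set" where
  "links_at G X = {Link {|e, f|} | e f. e \<in> edges G \<and> f \<in> edges G \<and> e \<noteq> f \<and>
     ends G e \<inter> ends G f \<inter> X \<noteq> {}}"

lemma links_atI:
  assumes "e \<in> edges G" "f \<in> edges G" "e \<noteq> f" "x \<in> ends G e" "x \<in> ends G f" "x \<in> X"
  shows "Link {|e, f|} \<in> links_at G X"
  unfolding links_at_def using assms by blast

lemma line_graph_simps:
  "verts (line_graph G) = edges G" "edges (line_graph G) = links_at G UNIV"
  "ends (line_graph G) (Link Y) = fset Y"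
  by (auto simp: line_graph_def links_at_def)

lemma links_at_mono: "X \<subseteq> Y \<Longrightarrow> links_at G X \<subseteq> links_at G Y"
  unfolding links_at_def by blast

text \<open>The last conjunct makes the induction work: a new first edge is not in the rest of the
  list, hence in none of the links used so far, so its link is new. It serves again when the walk is
  closed up to a cycle.\<close>

lemma edge_list_imp_walk:
  assumes "L \<noteq> []" "set L \<subseteq> edges G" "distinct L"
    "successively (\<lambda>e f. ends G e \<inter> ends G f \<inter> X \<noteq> {}) L"
  shows "\<exists>ls. walk (line_graph G) L ls \<and> distinct ls \<and> set ls \<subseteq> links_at G X \<and>
    (\<forall>Y. Link Y \<in> set ls \<longrightarrow> fset Y \<subseteq> set L)"
  using assms
proof (induction L rule: induct_list012)
  case (2 a)
  then show ?case by (intro exI[of _ "[]"]) (auto simp: walk_single line_graph_def)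
next
  case (3 a b L)
  then obtain ls where ls: "walk (line_graph G) (b # L) ls" "distinct ls" "set ls \<subseteq> links_at G X"
    "\<forall>Y. Link Y \<in> set ls \<longrightarrow> fset Y \<subseteq> set (b # L)" by auto
  have "Link {|a, b|} \<in> links_at G X" using 3 by (auto intro: links_atI)
  moreover from this have "walk (line_graph G) (a # b # L) (Link {|a, b|} # ls)"
    unfolding walk_Cons using 3 ls links_at_mono[of X UNIV G] by (auto simp: line_graph_simps)
  moreover have "Link {|a, b|} \<notin> set ls"
    using ls(4) 3 by fastforce
  ultimately show ?case using ls by (intro exI[of _ "Link {|a, b|} # ls"]) fastforce
qed simp

lemma ends_meet:
  assumes "mgraph G" "e \<in> edges G" "ends G e \<subseteq> X"
  shows "ends G e \<inter> X \<noteq> {}"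
proof -
  have "card (ends G e) = 2" using assms by (simp add: mgraph_def)
  then have "ends G e \<noteq> {}" by auto
  then show ?thesis using assms(3) by blast
qed

lemma incident_verts: "mgraph G \<Longrightarrow> incident G (verts G) = edges G"
  using ends_meet[of G _ "verts G"] by (auto simp: incident_def mgraph_def)

text \<open>Take for \<open>Q\<close> all edges off the trail. The edges on it have their ends in
  \<open>X\<close>, so every edge at \<open>X\<close> is listed.\<close>

lemma trail_sets_incident_edge_list:
  assumes "mgraph G" "trail_sets G u w X F"
  shows "\<exists>L. distinct L \<and> set L = incident G X \<and>
    successively (\<lambda>e f. ends G e \<inter> ends G f \<inter> X \<noteq> {}) L \<and>
    (L \<noteq> [] \<longrightarrow> u \<in> ends G (hd L) \<and> w \<in> ends G (last L))"
proof -
  have "ends G e \<inter> X \<noteq> {}" if "e \<in> F" for e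
    using that trail_sets_props(3,4)[OF assms(2)] by (intro ends_meet[OF assms(1)]) auto
  then have F: "F \<union> {e \<in> edges G - F. ends G e \<inter> X \<noteq> {}} = incident G X"
    using trail_sets_props(3)[OF assms(2)] by (auto simp: incident_def)
  have "finite (edges G - F)" "(edges G - F) \<inter> F = {}" using assms(1) by (auto simp: mgraph_def)
  then show ?thesis using trail_sets_imp_edge_list[OF assms(2), of "edges G - F"] unfolding F by blast
qed

lemma trail_sets_line_graph:
  assumes "mgraph G" "trail_sets G u w X F" "incident G X \<noteq> {}"
  shows "\<exists>a b F'. trail_sets (line_graph G) a b (incident G X) F' \<and> F' \<subseteq> links_at G X"
proof -
  obtain L where L: "distinct L" "set L = incident G X"
    "successively (\<lambda>e f. ends G e \<inter> ends G f \<inter> X \<noteq> {}) L"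
    using trail_sets_incident_edge_list[OF assms(1,2)] by blast
  have "L \<noteq> []" using L assms by auto
  then obtain ls where "walk (line_graph G) L ls" "distinct ls" "set ls \<subseteq> links_at G X"
    using edge_list_imp_walk[OF _ _ L(1,3)] L(2) by (auto simp: incident_def)
  then show ?thesis using trail_imp_trail_sets L(2) by metis
qed

text \<open>A spanning trail meets every edge, so all edges are listed, each once, and the walk
  through them is a hamiltonian path. This is in the spirit of the Harary-Nash-Williams
  correspondence.\<close>

lemma traceable_line_graph:
  assumes "mgraph G" "trail_sets G u w (verts G) F" "edges G \<noteq> {}"
  shows "traceable (line_graph G)"
proof -
  obtain L where L: "distinct L" "set L = edges G"
    "successively (\<lambda>e f. ends G e \<inter> ends G f \<inter> verts G \<noteq> {}) L"
    using trail_sets_incident_edge_list[OF assms(1,2)] incident_verts[OF assms(1)] by auto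
  have "L \<noteq> []" using L assms by auto
  then obtain ls where "walk (line_graph G) L ls"
    using edge_list_imp_walk[OF _ _ L(1,3)] L(2) by auto
  then show ?thesis using L unfolding traceable_def path_def by (auto simp: line_graph_def)
qed

text \<open>The first and last edges in the list share the base vertex \<open>u\<close>, so one more
  link closes the path to a cycle. The bound on \<open>F'\<close> allows the construction to be
  repeated in the next line graph.\<close>

lemma closed_trail_sets_line_graph:
  assumes "mgraph G" "trail_sets G u u X F" "card (incident G X) \<ge> 3"
  shows "\<exists>a F'. trail_sets (line_graph G) a a (incident G X) F' \<and> F' \<subseteq> links_at G X \<and> card F' \<ge> 3"
proof -
  obtain L where L: "distinct L" "set L = incident G X"
    "successively (\<lambda>e f. ends G e \<inter> ends G f \<inter> X \<noteq> {}) L"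
    "L \<noteq> [] \<longrightarrow> u \<in> ends G (hd L) \<and> u \<in> ends G (last L)"
    using trail_sets_incident_edge_list[OF assms(1,2)] by blast
  \<comment> \<open>With three or more edges in the list, the last one differs from both
    \<open>a\<close> and \<open>b\<close>, so the closing link is not a link already used.\<close>
  have len: "length L \<ge> 3" using L assms by (metis distinct_card)
  then obtain a b c N where "L = a # b # c # N"
    by (auto simp: numeral_3_eq_3 Suc_le_length_iff)
  then obtain M where M: "L = a # b # M" "M \<noteq> []" by blast
  have L_edges: "set L \<subseteq> edges G" using L by (auto simp: incident_def)
  have sM: "successively (\<lambda>e f. ends G e \<inter> ends G f \<inter> X \<noteq> {}) (b # M)" using L(3) M by auto
  obtain ls where ls: "walk (line_graph G) (b # M) ls" "distinct ls" "set ls \<subseteq> links_at G X"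
    "\<forall>Y. Link Y \<in> set ls \<longrightarrow> fset Y \<subseteq> set (b # M)"
    using edge_list_imp_walk[OF _ _ _ sM] L(1) L_edges M by auto
  let ?z = "last M"
  have z: "?z \<in> set M" using M by simp
  have uX: "u \<in> X" using trail_sets_props[OF assms(2)] by blast
  have ab: "Link {|a, b|} \<in> links_at G X" "Link {|a, b|} \<notin> set ls"
  proof -
    have ab: "a \<in> edges G" "b \<in> edges G" "a \<noteq> b" "a \<notin> set (b # M)" using L(1) L_edges M by auto
    have "ends G a \<inter> ends G b \<inter> X \<noteq> {}" using L(3) M by simp
    then show "Link {|a, b|} \<in> links_at G X" using ab by (blast intro: links_atI)
    show "Link {|a, b|} \<notin> set ls" using ls(4) ab(4) by force
  qed
  have za: "Link {|?z, a|} \<in> links_at G X"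
    using L(1,4) L_edges M z uX by (intro links_atI[of _ _ _ u]) auto
  have za': "Link {|?z, a|} \<notin> set ls" "Link {|?z, a|} \<noteq> Link {|a, b|}"
  proof -
    have "a \<notin> set (b # M)" using L(1) M by auto
    then show "Link {|?z, a|} \<notin> set ls" using ls(4) by force
    have "?z \<noteq> a" "?z \<noteq> b" using L(1) M z by auto
    then have "?z |\<notin>| {|a, b|}" "?z |\<in>| {|?z, a|}" by auto
    then have "{|?z, a|} \<noteq> {|a, b|}" by metis
    then show "Link {|?z, a|} \<noteq> Link {|a, b|}" by simp
  qed
  have "links_at G X \<subseteq> links_at G UNIV" by (simp add: links_at_mono)
  then have "walk (line_graph G) (a # b # M) (Link {|a, b|} # ls)"
    unfolding walk_Cons line_graph_simps using L_edges M(1) ls(1) ab(1) by auto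
  then have "walk (line_graph G) (?z # L) (Link {|?z, a|} # Link {|a, b|} # ls)"
    unfolding M(1) walk_Cons line_graph_simps
    using \<open>links_at G X \<subseteq> links_at G UNIV\<close> L_edges M(1) z za by auto
  then obtain k l where kl: "walk (line_graph G) (?z # L) (k # l # ls)"
    "k \<in> links_at G X" "l \<in> links_at G X" "k \<noteq> l" "k \<notin> set ls" "l \<notin> set ls"
    using that[OF _ za ab(1) za'(2,1) ab(2)] by blast
  then have dist: "distinct (k # l # ls)" using ls(2) by simp
  have "trail_sets (line_graph G) (hd (?z # L)) (last (?z # L)) (set (?z # L)) (set (k # l # ls))"
    by (rule trail_imp_trail_sets[OF kl(1) dist])
  moreover have "hd (?z # L) = ?z" "last (?z # L) = ?z" using M by simp_all
  moreover have "?z \<in> set L" using z unfolding M(1) by simp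
  then have "set (?z # L) = incident G X" unfolding L(2)[symmetric] list.set by (rule insert_absorb)
  ultimately have "trail_sets (line_graph G) ?z ?z (incident G X) (set (k # l # ls))" by simp
  \<comment> \<open>The links at \<open>a\<close> are two; the path from \<open>b\<close> to the
    last edge contributes a third.\<close>
  moreover have "length ls \<ge> 1" using ls(1) M by (cases M) (auto simp: walk_def)
  then have "card (set (k # l # ls)) \<ge> 3" unfolding distinct_card[OF dist] by simp
  moreover have "set (k # l # ls) \<subseteq> links_at G X" using ls(3) kl by simp
  ultimately show ?thesis by blast
qed

section \<open>Connectedness, small degrees and the number of uncovered vertices in the line
  graph\<close>

lemma mgraph_line_graph:
  assumes "mgraph G" shows "mgraph (line_graph G)"
proof -
  have "finite ((\<lambda>(e, f). Link {|e, f|}) ` (edges G \<times> edges G))"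
    using assms by (auto simp: mgraph_def)
  then have "finite (edges (line_graph G))"
    by (rule rev_finite_subset) (auto simp: line_graph_def)
  then show ?thesis using assms by (auto simp: mgraph_def line_graph_def)
qed

text \<open>If no edge in \<open>S\<close> met an edge outside \<open>S\<close>, the ends of the
  edges in \<open>S\<close> would form a nonempty proper vertex set that no edge leaves.\<close>

lemma cut_connected_line_graph:
  assumes "mgraph G" "cut_connected G" "edges G \<noteq> {}"
  shows "cut_connected (line_graph G)"
  unfolding cut_connected_def
proof (intro conjI allI impI)
  fix S assume S: "S \<subseteq> verts (line_graph G)" "S \<noteq> {}" "S \<noteq> verts (line_graph G)"
  have SE: "S \<subseteq> edges G" "S \<noteq> edges G" using S by (auto simp: line_graph_def)
  have ne: "ends G e \<noteq> {}" "ends G e \<subseteq> verts G" if "e \<in> edges G" for e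
    using assms(1) that by (auto simp: mgraph_def)
  have "\<exists>e f. e \<in> S \<and> f \<in> edges G - S \<and> ends G e \<inter> ends G f \<noteq> {}"
  proof (rule ccontr)
    assume no: "\<nexists>e f. e \<in> S \<and> f \<in> edges G - S \<and> ends G e \<inter> ends G f \<noteq> {}"
    define W where "W = (\<Union>e\<in>S. ends G e)"
    obtain e f where ef: "e \<in> S" "f \<in> edges G - S" using S SE by blast
    then have "W \<subseteq> verts G" "W \<noteq> {}" using SE ne by (fastforce simp: W_def)+
    moreover have "W \<noteq> verts G" using ef no ne[of f] unfolding W_def by blast
    ultimately obtain g where g: "g \<in> edges G" "ends G g \<inter> W \<noteq> {}" "ends G g - W \<noteq> {}"
      using assms(2) unfolding cut_connected_def by meson
    show False
    proof (cases "g \<in> S")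
      case True then show False using g unfolding W_def by blast
    next
      case False then show False using g no unfolding W_def by blast
    qed
  qed
  then obtain e f where "e \<in> S" "f \<in> edges G - S" "ends G e \<inter> ends G f \<noteq> {}" by blast
  then show "\<exists>l\<in>edges (line_graph G). ends (line_graph G) l \<inter> S \<noteq> {} \<and> ends (line_graph G) l - S \<noteq> {}"
    using SE by (intro bexI[of _ "Link {|e, f|}"]) (auto simp: line_graph_def)
qed (use assms in \<open>simp add: line_graph_def\<close>)

text \<open>Each of the two ends of \<open>e\<close> lies on at most one further edge.\<close>

lemma degree_line_graph_le_2:
  assumes "mgraph G" "e \<in> edges G" "\<And>x. x \<in> ends G e \<Longrightarrow> degree G x \<le> 2"
  shows "degree (line_graph G) e \<le> 2"
proof -
  obtain x y where xy: "ends G e = {x, y}" using assms by (auto simp: mgraph_def card_2_iff)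
  define I where "I v = {f \<in> edges G. v \<in> ends G f}" for v
  have I: "card (I v - {e}) \<le> 1" "finite (I v)" if "v \<in> {x, y}" for v
  proof -
    show "finite (I v)" using assms by (auto simp: mgraph_def I_def)
    have "e \<in> I v" using that assms xy by (auto simp: I_def)
    then show "card (I v - {e}) \<le> 1" using assms(3)[of v] that xy
      by (auto simp: degree_def I_def card_Diff_singleton)
  qed
  have "{l \<in> edges (line_graph G). e \<in> ends (line_graph G) l} \<subseteq>
      (\<lambda>f. Link {|e, f|}) ` ((I x - {e}) \<union> (I y - {e}))"
  proof
    fix l assume "l \<in> {l \<in> edges (line_graph G). e \<in> ends (line_graph G) l}"
    then have l: "l \<in> edges (line_graph G)" "e \<in> ends (line_graph G) l" by auto
    then obtain f g where fg: "l = Link {|f, g|}" "f \<in> edges G" "g \<in> edges G" "f \<noteq> g"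
      "ends G f \<inter> ends G g \<noteq> {}"
      unfolding line_graph_simps links_at_def by auto
    then have "e \<in> fset {|f, g|}" using l(2) by (simp add: line_graph_simps)
    then have "e = f \<or> e = g" by simp
    define h where "h = (if e = f then g else f)"
    have h: "l = Link {|e, h|}" "h \<in> edges G" "h \<noteq> e" "ends G e \<inter> ends G h \<noteq> {}"
      using fg \<open>e = f \<or> e = g\<close> by (auto simp: h_def finsert_commute)
    then have "h \<in> (I x - {e}) \<union> (I y - {e})" using xy by (auto simp: I_def)
    with h(1) show "l \<in> (\<lambda>f. Link {|e, f|}) ` ((I x - {e}) \<union> (I y - {e}))" by (rule image_eqI)
  qed
  then have "degree (line_graph G) e \<le> card ((\<lambda>f. Link {|e, f|}) ` ((I x - {e}) \<union> (I y - {e})))"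
    unfolding degree_def using I by (intro card_mono) auto
  also have "\<dots> \<le> card ((I x - {e}) \<union> (I y - {e}))" using I by (intro card_image_le) auto
  also have "\<dots> \<le> card (I x - {e}) + card (I y - {e})" by (rule card_Un_le)
  also have "\<dots> \<le> 2" using I(1)[of x] I(1)[of y] by simp
  finally show ?thesis .
qed

text \<open>Count incidences between \<open>U\<close> and the edges. Every edge inside
  \<open>U\<close> gives two, an edge leaving \<open>U\<close> at least one more, and the degrees
  bound the total by twice \<open>card U\<close>. The crossing edge makes the inequality
  strict.\<close>

lemma card_inner_edges_less:
  assumes "mgraph G" "cut_connected G" "U \<subseteq> verts G" "U \<noteq> {}" "U \<noteq> verts G"
    "\<And>u. u \<in> U \<Longrightarrow> degree G u \<le> 2"
  shows "card {e \<in> edges G. ends G e \<subseteq> U} < card U"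
proof -
  have fin: "finite (edges G)" "finite U" using assms finite_subset by (auto simp: mgraph_def)
  let ?D = "{e \<in> edges G. ends G e \<subseteq> U}"
  obtain g where g: "g \<in> edges G" "ends G g \<inter> U \<noteq> {}" "ends G g - U \<noteq> {}"
    using assms(2-5) unfolding cut_connected_def by meson
  have fe: "finite (ends G e)" if "e \<in> edges G" for e
    using that assms(1) by (auto simp: mgraph_def intro: finite_subset)
  have "2 * card ?D + 1 \<le> (\<Sum>e\<in>?D. card (ends G e \<inter> U)) + card (ends G g \<inter> U)"
  proof -
    have "(\<Sum>e\<in>?D. card (ends G e \<inter> U)) = (\<Sum>e\<in>?D. 2)"
      using assms(1) by (intro sum.cong) (auto simp: mgraph_def Int_absorb2)
    moreover have "card (ends G g \<inter> U) \<ge> 1"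
      using g fe by (simp add: Suc_le_eq card_gt_0_iff)
    ultimately show ?thesis by simp
  qed
  also have "\<dots> = (\<Sum>e\<in>insert g ?D. card (ends G e \<inter> U))"
    using g fin by (subst sum.insert) auto
  also have "\<dots> \<le> (\<Sum>e\<in>edges G. card (ends G e \<inter> U))"
    using g fin by (intro sum_mono2) auto
  also have "\<dots> = (\<Sum>e\<in>edges G. card {u \<in> U. u \<in> ends G e})"
    by (intro sum.cong arg_cong[of _ _ card]) auto
  also have "\<dots> = (\<Sum>u\<in>U. degree G u)"
    unfolding degree_def by (rule sum_multicount_gen) (use fin in auto)
  also have "\<dots> \<le> (\<Sum>u\<in>U. 2)" using assms by (intro sum_mono) auto
  finally show ?thesis by simp
qed


section \<open>Covers by edge-disjoint trails, and their reduction to separated ones\<close>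

text \<open>One open trail \<open>(X0, F0)\<close> and a set \<open>C\<close> of closed ones. The bound 3 makes the edges at a closed
  trail form a cycle of the simple graph \<open>L(G)\<close>, not just an edge traversed twice.\<close>

definition cover :: "('v, 'e) mgraph \<Rightarrow> 'v set \<Rightarrow> 'e set \<Rightarrow> ('v set \<times> 'e set) set \<Rightarrow> bool" where
  "cover G X0 F0 C \<longleftrightarrow> (\<exists>u v. trail_sets G u v X0 F0) \<and> finite C \<and>
     (\<forall>p\<in>C. (\<exists>u. trail_sets G u u (fst p) (snd p)) \<and> 3 \<le> card (incident G (fst p))) \<and>
     (\<forall>p\<in>C. F0 \<inter> snd p = {}) \<and> (\<forall>p\<in>C. \<forall>q\<in>C. p \<noteq> q \<longrightarrow> snd p \<inter> snd q = {})"

text \<open>Besides disjointness this forbids parallel edges between \<open>X\<close> and \<open>Y\<close>: these are the only way in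
  which a link at \<open>X\<close> can also be a link at \<open>Y\<close>.\<close>

definition separated :: "('v, 'e) mgraph \<Rightarrow> 'v set \<Rightarrow> 'v set \<Rightarrow> bool" where
  "separated G X Y \<longleftrightarrow> X \<inter> Y = {} \<and> (\<forall>e\<in>edges G. \<forall>f\<in>edges G. \<forall>x\<in>X. \<forall>y\<in>Y.
     ends G e = {x, y} \<longrightarrow> ends G f = {x, y} \<longrightarrow> e = f)"

text \<open>\<open>D\<close> holds the connecting edges: none if the two trails share a vertex, two
  parallel edges otherwise.\<close>

lemma cover_absorb_open:
  assumes "cover G X0 F0 C" "p \<in> C" "trail_sets G u v (X0 \<union> fst p) (F0 \<union> snd p \<union> D)"
    "\<And>q. q \<in> C - {p} \<Longrightarrow> D \<inter> snd q = {}"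
  shows "cover G (X0 \<union> fst p) (F0 \<union> snd p \<union> D) (C - {p})"
proof -
  have "(F0 \<union> snd p \<union> D) \<inter> snd q = {}" if "q \<in> C - {p}" for q
    using assms(1,2,4) that unfolding cover_def by blast
  then show ?thesis using assms unfolding cover_def by blast
qed

lemma cover_absorb_closed:
  assumes "mgraph G" "cover G X0 F0 C" "p \<in> C" "q \<in> C" "p \<noteq> q"
    "trail_sets G u u (fst p \<union> fst q) (snd p \<union> snd q \<union> D)"
    "D \<inter> F0 = {}" "\<And>r. r \<in> C - {p, q} \<Longrightarrow> D \<inter> snd r = {}"
  shows "cover G X0 F0 (insert (fst p \<union> fst q, snd p \<union> snd q \<union> D) (C - {p, q}))"
proof -
  let ?n = "(fst p \<union> fst q, snd p \<union> snd q \<union> D)"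
  have "F0 \<inter> snd ?n = {}" using assms(2-4,7) unfolding cover_def by auto
  moreover have new: "snd ?n \<inter> snd r = {}" if "r \<in> C - {p, q}" for r
  proof -
    have "snd p \<inter> snd r = {}" "snd q \<inter> snd r = {}"
      using assms(2-4) that unfolding cover_def by blast+
    then show ?thesis using assms(8)[OF that] by auto
  qed
  moreover have "3 \<le> card (incident G (fst ?n))"
  proof -
    have "card (incident G (fst p)) \<le> card (incident G (fst ?n))"
      using assms(1) by (intro card_mono) (auto simp: incident_def mgraph_def)
    then show ?thesis using assms(2,3) unfolding cover_def by fastforce
  qed
  moreover have "snd r \<inter> snd s = {}" if rs: "r \<in> insert ?n (C - {p, q})" "s \<in> insert ?n (C - {p, q})" "r \<noteq> s" for r s
  proof -
    consider "r \<in> C" "s \<in> C" | "r = ?n" "s \<in> C - {p, q}" | "s = ?n" "r \<in> C - {p, q}"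
      using rs by (elim insertE) auto
    then show ?thesis
    proof cases
      case 1
      then show ?thesis using assms(2) rs(3) unfolding cover_def by blast
    next
      case 2
      then show ?thesis using new by blast
    next
      case 3
      then show ?thesis using new by blast
    qed
  qed
  moreover have "\<exists>u. trail_sets G u u (fst ?n) (snd ?n)" using assms(6) by auto
  ultimately show ?thesis using assms(2) unfolding cover_def by simp
qed

lemma trail_sets_edge_ends_subset:
  "trail_sets G u v X F \<Longrightarrow> e \<in> F \<Longrightarrow> ends G e = {x, y} \<Longrightarrow> x \<in> X \<and> y \<in> X"
  using trail_sets_props(4) by fastforce

text \<open>Take a cover with the fewest closed trails. Trails that meet can be merged, and so can trails
  joined by two parallel edges, since these two edges form a closed trail.\<close>

lemma cover_imp_separated_cover:
  assumes G: "mgraph G" and "cover G X0 F0 C"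
  shows "\<exists>X F D. cover G X F D \<and> X \<union> \<Union>(fst ` D) = X0 \<union> \<Union>(fst ` C) \<and>
    (\<forall>p\<in>D. separated G X (fst p)) \<and> (\<forall>p\<in>D. \<forall>q\<in>D. p \<noteq> q \<longrightarrow> separated G (fst p) (fst q))"
proof -
  define K where "K = X0 \<union> \<Union>(fst ` C)"
  define P where "P n \<longleftrightarrow> (\<exists>X F D. cover G X F D \<and> X \<union> \<Union>(fst ` D) = K \<and> card D = n)" for n
  have "P (card C)" using assms(2) unfolding P_def K_def by blast
  then have "P (LEAST n. P n)" by (rule LeastI)
  then obtain X F D where cov: "cover G X F D" "X \<union> \<Union>(fst ` D) = K" "card D = (LEAST n. P n)"
    unfolding P_def by blast
  have min: "card D \<le> card D'" if "cover G X' F' D'" "X' \<union> \<Union>(fst ` D') = K" for X' F' D'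
    using that cov(3) Least_le[of P "card D'"] unfolding P_def by auto
  have finD: "finite D" using cov(1) by (simp add: cover_def)
  obtain u v where uv: "trail_sets G u v X F" using cov(1) unfolding cover_def by blast
  have cl: "\<exists>u. trail_sets G u u (fst p) (snd p)" if "p \<in> D" for p
    using cov(1) that unfolding cover_def by blast
  have dj0: "F \<inter> snd p = {}" if "p \<in> D" for p using cov(1) that unfolding cover_def by blast
  have dj: "snd p \<inter> snd q = {}" if "p \<in> D" "q \<in> D" "p \<noteq> q" for p q
    using cov(1) that unfolding cover_def by blast
  have no_open: False if p: "p \<in> D" and t: "trail_sets G u v (X \<union> fst p) (F \<union> snd p \<union> E)"
    and E: "\<And>q. q \<in> D - {p} \<Longrightarrow> E \<inter> snd q = {}" for p E
  proof -
    have "X \<union> fst p \<union> \<Union>(fst ` (D - {p})) = K" using cov(2) p by auto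
    then have "card D \<le> card (D - {p})" using min[OF cover_absorb_open[OF cov(1) p t E]] by blast
    then show False using card_Diff1_less[OF finD p] by simp
  qed
  have no_closed: False if p: "p \<in> D" "q \<in> D" "p \<noteq> q"
    and t: "trail_sets G w w (fst p \<union> fst q) (snd p \<union> snd q \<union> E)"
    and E: "E \<inter> F = {}" "\<And>r. r \<in> D - {p, q} \<Longrightarrow> E \<inter> snd r = {}" for p q E w
  proof -
    \<comment> \<open>Two closed trails give way to at most one new one, so the count drops although
      the covered vertices stay the same.\<close>
    let ?D = "insert (fst p \<union> fst q, snd p \<union> snd q \<union> E) (D - {p, q})"
    have "X \<union> \<Union>(fst ` ?D) = K" using cov(2) p by auto
    then have "card D \<le> card ?D" using min[OF cover_absorb_closed[OF G cov(1) p t E]] by blast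
    also have "\<dots> \<le> Suc (card (D - {p, q}))" by (simp add: card_insert_if finD)
    also have "card (D - {p, q}) = card D - 2" using p finD by (simp add: card_Diff_subset)
    finally show False using card_mono[OF finD, of "{p, q}"] p by simp
  qed
  have vdj0: "X \<inter> fst p = {}" if p: "p \<in> D" for p
  proof (rule ccontr)
    assume meet: "X \<inter> fst p \<noteq> {}"
    obtain w where "trail_sets G w w (fst p) (snd p)" using cl[OF p] by blast
    then have "trail_sets G u v (X \<union> fst p) (F \<union> snd p \<union> {})"
      using trail_sets_join[OF uv _ dj0[OF p] meet] by simp
    then show False using no_open[OF p] by blast
  qed
  have vdj: "fst p \<inter> fst q = {}" if p: "p \<in> D" "q \<in> D" "p \<noteq> q" for p q
  proof (rule ccontr)
    assume meet: "fst p \<inter> fst q \<noteq> {}"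
    obtain w w' where w: "trail_sets G w w (fst p) (snd p)" "trail_sets G w' w' (fst q) (snd q)"
      using cl p by blast
    have "trail_sets G w w (fst p \<union> fst q) (snd p \<union> snd q \<union> {})"
      using trail_sets_join[OF w dj[OF p] meet] by simp
    then show False using no_closed[OF p] by blast
  qed
  have "separated G X (fst p)" if p: "p \<in> D" for p
    unfolding separated_def
  proof (intro conjI vdj0[OF p] ballI impI)
    fix e f x y
    assume ef: "e \<in> edges G" "f \<in> edges G" "x \<in> X" "y \<in> fst p" "ends G e = {x, y}" "ends G f = {x, y}"
    obtain w where w: "trail_sets G w w (fst p) (snd p)" using cl[OF p] by blast
    \<comment> \<open>A trail contains both ends of each of its edges, but no trail contains both
      \<open>x\<close> and \<open>y\<close>, as the trails are already known to be vertex-disjoint.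
      So \<open>e\<close> and \<open>f\<close> are free to be used, and \<open>e \<noteq> f\<close>
      would permit a merger.\<close>
    have "{e, f} \<inter> snd q = {}" if "q \<in> D" for q
      using cl[OF that] trail_sets_edge_ends_subset[of G _ _ "fst q" "snd q" _ x y] ef vdj0[OF that] by blast
    moreover have "{e, f} \<inter> F = {}"
      using uv trail_sets_edge_ends_subset[of G _ _ X F _ x y] ef vdj0[OF p] by blast
    ultimately show "e = f"
      using no_open[OF p, of "{e, f}"] trail_sets_join_parallel[OF G uv w dj0[OF p] ef(1,2) _ ef(5,6,3,4)] p
      by blast
  qed
  moreover have "separated G (fst p) (fst q)" if p: "p \<in> D" "q \<in> D" "p \<noteq> q" for p q
    unfolding separated_def
  proof (intro conjI vdj[OF p] ballI impI)
    fix e f x y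
    assume ef: "e \<in> edges G" "f \<in> edges G" "x \<in> fst p" "y \<in> fst q" "ends G e = {x, y}" "ends G f = {x, y}"
    obtain w w' where w: "trail_sets G w w (fst p) (snd p)" "trail_sets G w' w' (fst q) (snd q)" using cl p by blast
    have "{e, f} \<inter> snd r = {}" if "r \<in> D" for r
    proof -
      have "\<not> (x \<in> fst r \<and> y \<in> fst r)" using ef vdj[OF that p(1)] vdj[OF that p(2)] p(3) by blast
      then show ?thesis using cl[OF that] trail_sets_edge_ends_subset[of G _ _ "fst r" "snd r" _ x y] ef by blast
    qed
    moreover have "{e, f} \<inter> F = {}"
      using uv trail_sets_edge_ends_subset[of G _ _ X F _ x y] ef vdj0[OF p(1)] by blast
    ultimately show "e = f"
      using no_closed[OF p, of _ "{e, f}"] trail_sets_join_parallel[OF G w dj[OF p] ef(1,2) _ ef(5,6,3,4)] p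
      by blast
  qed
  ultimately show ?thesis using cov(1,2) unfolding K_def
    by (intro exI[of _ X] exI[of _ F] exI[of _ D]) simp
qed

section \<open>Passing a cover to the line graph\<close>

text \<open>Two edges that share some \<open>x\<close> in \<open>X\<close> and some \<open>y\<close>
  in \<open>Y\<close> have exactly these two ends, so they are parallel, which separation
  excludes.\<close>

lemma links_at_disjoint:
  assumes "mgraph G" "separated G X Y"
  shows "links_at G X \<inter> links_at G Y = {}"
proof (rule ccontr)
  assume "links_at G X \<inter> links_at G Y \<noteq> {}"
  then obtain l where "l \<in> links_at G X" "l \<in> links_at G Y" by blast
  then obtain e f e' f' x y where l: "l = Link {|e, f|}" "e \<in> edges G" "f \<in> edges G" "e \<noteq> f"
    "x \<in> ends G e" "x \<in> ends G f" "x \<in> X" "l = Link {|e', f'|}" "y \<in> ends G e'" "y \<in> ends G f'" "y \<in> Y"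
    unfolding links_at_def by blast
  have "{e, f} = {e', f'}" using l(1,8) by (auto simp: fset_eq_iff)
  then have y: "y \<in> ends G e" "y \<in> ends G f" using l by (auto simp: doubleton_eq_iff)
  have "x \<noteq> y" using assms(2) l unfolding separated_def by blast
  have two: "ends G g = {x, y}" if "g \<in> edges G" "x \<in> ends G g" "y \<in> ends G g" for g
  proof -
    have "card (ends G g) = 2" using assms(1) that by (simp add: mgraph_def)
    then show ?thesis using that \<open>x \<noteq> y\<close> by (auto simp: card_2_iff)
  qed
  show False using assms(2) l two y unfolding separated_def by blast
qed

text \<open>Each trail is carried over on its own. The images may share vertices, since an edge
  between two trails belongs to both, but they use links at separated vertex sets and so remain
  edge-disjoint.\<close>

lemma cover_line_graph:
  assumes G: "mgraph G" and cov: "cover G X0 F0 C" and "incident G X0 \<noteq> {}"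
    and sep0: "\<And>p. p \<in> C \<Longrightarrow> separated G X0 (fst p)"
    and sep: "\<And>p q. p \<in> C \<Longrightarrow> q \<in> C \<Longrightarrow> p \<noteq> q \<Longrightarrow> separated G (fst p) (fst q)"
  shows "\<exists>F D. cover (line_graph G) (incident G X0) F D \<and> fst ` D = incident G ` fst ` C"
proof -
  have "\<exists>a H. trail_sets (line_graph G) a a (incident G (fst p)) H \<and> H \<subseteq> links_at G (fst p) \<and> card H \<ge> 3"
    if "p \<in> C" for p
  proof -
    obtain w where "trail_sets G w w (fst p) (snd p)" "3 \<le> card (incident G (fst p))"
      using cov \<open>p \<in> C\<close> unfolding cover_def by blast
    then show ?thesis using closed_trail_sets_line_graph[OF G] by blast
  qed
  then obtain a H where H: "\<And>p. p \<in> C \<Longrightarrow> trail_sets (line_graph G) (a p) (a p) (incident G (fst p)) (H p)"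
    "\<And>p. p \<in> C \<Longrightarrow> H p \<subseteq> links_at G (fst p)" "\<And>p. p \<in> C \<Longrightarrow> card (H p) \<ge> 3"
    by metis
  obtain u v where "trail_sets G u v X0 F0" using cov unfolding cover_def by blast
  then obtain b c F where F: "trail_sets (line_graph G) b c (incident G X0) F" "F \<subseteq> links_at G X0"
    using trail_sets_line_graph[OF G] assms(3) by blast
  let ?D = "(\<lambda>p. (incident G (fst p), H p)) ` C"
  note L = mgraph_line_graph[OF G]
  have "3 \<le> card (incident (line_graph G) (incident G (fst p)))" if "p \<in> C" for p
  proof -
    \<comment> \<open>The new closed trail has at least three edges, all with their ends on it; this
      renews the bound 3 that a cover demands.\<close>
    have "H p \<subseteq> incident (line_graph G) (incident G (fst p))"
    proof
      fix l assume "l \<in> H p"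
      then have "l \<in> edges (line_graph G)" "ends (line_graph G) l \<subseteq> incident G (fst p)"
        using trail_sets_props(3,4)[OF H(1)[OF that]] by auto
      then show "l \<in> incident (line_graph G) (incident G (fst p))"
        using ends_meet[OF L] by (simp add: incident_def[of "line_graph G"])
    qed
    moreover have "finite (incident (line_graph G) (incident G (fst p)))"
      using L by (auto simp: incident_def mgraph_def)
    ultimately show ?thesis using card_mono H(3)[OF that] by (meson le_trans)
  qed
  then have 1: "\<forall>p\<in>?D. (\<exists>u. trail_sets (line_graph G) u u (fst p) (snd p)) \<and>
      3 \<le> card (incident (line_graph G) (fst p))"
    using H(1) by fastforce
  have 2: "F \<inter> H p = {}" if "p \<in> C" for p
    using F(2) H(2)[OF that] links_at_disjoint[OF G sep0[OF that]] by blast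
  have 3: "H p \<inter> H q = {}" if "p \<in> C" "q \<in> C" "p \<noteq> q" for p q
    using H(2)[OF that(1)] H(2)[OF that(2)] links_at_disjoint[OF G sep[OF that]] by blast
  have 4: "\<forall>p\<in>?D. \<forall>q\<in>?D. p \<noteq> q \<longrightarrow> snd p \<inter> snd q = {}"
  proof (intro ballI impI)
    fix p q assume "p \<in> ?D" "q \<in> ?D" "p \<noteq> q"
    then obtain p' q' where *: "p' \<in> C" "q' \<in> C" "p = (incident G (fst p'), H p')"
      "q = (incident G (fst q'), H q')" by blast
    with \<open>p \<noteq> q\<close> have "p' \<noteq> q'" by blast
    with * 3 show "snd p \<inter> snd q = {}" by simp
  qed
  have "finite ?D" using cov by (simp add: cover_def)
  then have "cover (line_graph G) (incident G X0) F ?D"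
    unfolding cover_def using F(1) 1 2 4 by (intro conjI) auto
  moreover have "fst ` ?D = incident G ` fst ` C" by (simp add: image_image)
  ultimately show ?thesis by blast
qed

section \<open>Merging a cover into one trail, and the induction over line graphs\<close>

text \<open>Absorb the closed trails one at a time: as long as some remain, \<open>meet\<close>
  provides one that shares a vertex with the trail built so far.\<close>

lemma cover_merge:
  assumes cov: "cover G X0 F0 C"
    and meet: "\<And>A. A \<subset> C \<Longrightarrow> (X0 \<union> \<Union>(fst ` A)) \<inter> \<Union>(fst ` (C - A)) \<noteq> {}"
  shows "\<exists>u v F. trail_sets G u v (X0 \<union> \<Union>(fst ` C)) F"
proof -
  obtain u v where uv: "trail_sets G u v X0 F0" using cov unfolding cover_def by blast
  have fin: "finite C" using cov by (simp add: cover_def)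
  have dj0: "F0 \<inter> snd p = {}" if "p \<in> C" for p using cov that unfolding cover_def by blast
  have dj: "snd p \<inter> snd q = {}" if "p \<in> C" "q \<in> C" "p \<noteq> q" for p q
    using cov that unfolding cover_def by blast
  have "n \<le> card C \<Longrightarrow>
    \<exists>A\<subseteq>C. card A = n \<and> trail_sets G u v (X0 \<union> \<Union>(fst ` A)) (F0 \<union> \<Union>(snd ` A))" for n
  proof (induction n)
    case 0
    then show ?case using uv by (intro exI[of _ "{}"]) auto
  next
    case (Suc n)
    then obtain A where A: "A \<subseteq> C" "card A = n" "trail_sets G u v (X0 \<union> \<Union>(fst ` A)) (F0 \<union> \<Union>(snd ` A))"
      by auto
    then have "A \<subset> C" using Suc.prems by auto
    from meet[OF this] obtain x where "x \<in> X0 \<union> \<Union>(fst ` A)" "x \<in> \<Union>(fst ` (C - A))" by blast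
    then obtain p where p: "p \<in> C - A" "(X0 \<union> \<Union>(fst ` A)) \<inter> fst p \<noteq> {}" by blast
    obtain w where w: "trail_sets G w w (fst p) (snd p)" using cov p unfolding cover_def by blast
    have "snd q \<inter> snd p = {}" if "q \<in> A" for q
      by (rule dj) (use that p(1) A(1) in auto)
    moreover have "F0 \<inter> snd p = {}" using dj0 p(1) by blast
    ultimately have "(F0 \<union> \<Union>(snd ` A)) \<inter> snd p = {}" by blast
    then have "trail_sets G u v (X0 \<union> \<Union>(fst ` A) \<union> fst p) (F0 \<union> \<Union>(snd ` A) \<union> snd p)"
      using trail_sets_join[OF A(3) w] p by blast
    moreover have "X0 \<union> \<Union>(fst ` A) \<union> fst p = X0 \<union> \<Union>(fst ` insert p A)"
      "F0 \<union> \<Union>(snd ` A) \<union> snd p = F0 \<union> \<Union>(snd ` insert p A)" by auto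
    moreover have "card (insert p A) = Suc n" using A p finite_subset[OF _ fin] by auto
    ultimately show ?case using A(1) p by (intro exI[of _ "insert p A"]) auto
  qed
  then obtain A where "A \<subseteq> C" "card A = card C" "trail_sets G u v (X0 \<union> \<Union>(fst ` A)) (F0 \<union> \<Union>(snd ` A))"
    by blast
  then show ?thesis using card_subset_eq[OF fin] by blast
qed

lemma cut_connected_edge_at:
  assumes "mgraph G" "cut_connected G" "edges G \<noteq> {}" "x \<in> verts G"
  shows "\<exists>e\<in>edges G. x \<in> ends G e"
proof (cases "verts G = {x}")
  case True
  obtain e where "e \<in> edges G" using assms by blast
  then show ?thesis using ends_meet[OF assms(1), of e "verts G"] True assms(1)
    by (auto simp: mgraph_def)
next
  case False
  then have "\<exists>e\<in>edges G. ends G e \<inter> {x} \<noteq> {} \<and> ends G e - {x} \<noteq> {}"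
    using assms(2,4) unfolding cut_connected_def
    by (metis empty_subsetI insert_not_empty insert_subset)
  then show ?thesis by auto
qed

lemma traceable_no_edges:
  assumes "cut_connected G" "edges G = {}"
  shows "traceable G"
proof -
  obtain x where x: "x \<in> verts G" using assms unfolding cut_connected_def by blast
  have "verts G = {x}"
  proof (rule ccontr)
    assume "verts G \<noteq> {x}"
    then show False using assms x unfolding cut_connected_def
      by (metis empty_iff empty_subsetI insert_not_empty insert_subset)
  qed
  then show ?thesis unfolding traceable_def path_def
    by (intro exI[of _ "[x]"] exI[of _ "[]"]) (auto simp: walk_single)
qed

text \<open>Induction on the number of uncovered vertices, for all graphs and covers at once. One
  line graph step lowers this number; the extra 2 pays for the two steps needed once nothing is
  uncovered.\<close>

lemma traceable_iterated_line_graph: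
  assumes "mgraph G" "cut_connected G" "cover G X0 F0 C"
    "\<And>u. u \<in> verts G - (X0 \<union> \<Union>(fst ` C)) \<Longrightarrow> degree G u \<le> 2"
  shows "\<exists>m \<le> card (verts G - (X0 \<union> \<Union>(fst ` C))) + 2. traceable ((line_graph ^^ m) G)"
  using assms
proof (induction "card (verts G - (X0 \<union> \<Union>(fst ` C)))" arbitrary: G X0 F0 C rule: less_induct)
  case less
  note G = less.prems(1) and con = less.prems(2)
  define U where "U = verts G - (X0 \<union> \<Union>(fst ` C))"
  show ?case
  proof (cases "edges G = {}")
    case True
    then show ?thesis using traceable_no_edges[OF con] by (intro exI[of _ 0]) auto
  next
    case False
    \<comment> \<open>Separation is what lets the cover pass to the line graph; the covered set, and
      with it \<open>U\<close>, does not change.\<close>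
    from cover_imp_separated_cover[OF G less.prems(3)]
    obtain X F D where D: "cover G X F D" "X \<union> \<Union>(fst ` D) = X0 \<union> \<Union>(fst ` C)"
      and sep0: "\<forall>p\<in>D. separated G X (fst p)"
      and sep: "\<forall>p\<in>D. \<forall>q\<in>D. p \<noteq> q \<longrightarrow> separated G (fst p) (fst q)"
      by (elim exE conjE) (rule that)
    obtain u v where uv: "trail_sets G u v X F" using D(1) unfolding cover_def by blast
    have X: "X \<noteq> {}" "X \<subseteq> verts G" using trail_sets_props[OF uv] by auto
    have members: "fst p \<subseteq> verts G" "fst p \<noteq> {}" if "p \<in> D" for p
    proof -
      obtain w where "trail_sets G w w (fst p) (snd p)" using D(1) \<open>p \<in> D\<close> unfolding cover_def by blast
      from trail_sets_props(1,2)[OF this] show "fst p \<subseteq> verts G" "fst p \<noteq> {}" by auto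
    qed
    have UK: "U = verts G - (X \<union> \<Union>(fst ` D))" unfolding U_def D(2) ..
    obtain x where "x \<in> X" using X by blast
    then have "incident G X \<noteq> {}"
      using cut_connected_edge_at[OF G con False, of x] X by (auto simp: incident_def)
    then obtain F' D' where D': "cover (line_graph G) (incident G X) F' D'" "fst ` D' = incident G ` fst ` D"
      using cover_line_graph[OF G D(1)] sep0 sep by metis
    have K': "incident G X \<union> \<Union>(fst ` D') = incident G (X \<union> \<Union>(fst ` D))"
      unfolding D'(2) incident_def by blast
    have L: "mgraph (line_graph G)" "cut_connected (line_graph G)"
      using mgraph_line_graph[OF G] cut_connected_line_graph[OF G con False] by auto
    show ?thesis
    proof (cases "U = {}")
      case True
      then have K: "X \<union> \<Union>(fst ` D) = verts G" using UK X members by blast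
      \<comment> \<open>The images of the trails cannot fall apart into two groups without a common
        vertex: an edge of \<open>G\<close> that meets the vertices behind both groups is a vertex
        of the line graph lying in both.\<close>
      have "(incident G X \<union> \<Union>(fst ` A)) \<inter> \<Union>(fst ` (D' - A)) \<noteq> {}" if A: "A \<subset> D'" for A
      proof -
        \<comment> \<open>Pull the two groups back to \<open>G\<close>. The resulting vertex sets
          \<open>S\<close> and \<open>R\<close> together contain all vertices, but they may
          overlap.\<close>
        define XA where "XA = {Y \<in> fst ` D. incident G Y \<in> fst ` A}"
        define XB where "XB = {Y \<in> fst ` D. incident G Y \<in> fst ` (D' - A)}"
        define S where "S = X \<union> \<Union>XA"
        define R where "R = \<Union>XB"
        have "Y \<in> XA \<union> XB" if "Y \<in> fst ` D" for Y
        proof -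
          have "D' = A \<union> (D' - A)" using A by blast
          moreover have "incident G Y \<in> fst ` D'" unfolding D'(2) using that by (rule imageI)
          ultimately have "incident G Y \<in> fst ` A \<union> fst ` (D' - A)" by (metis image_Un)
          then show ?thesis using that by (simp add: XA_def XB_def)
        qed
        then have "fst ` D = XA \<union> XB" by (auto simp: XA_def XB_def simp del: image_iff)
        then have SR: "S \<union> R = verts G" using K by (simp add: S_def R_def Un_assoc)
        have XA: "incident G Y \<in> fst ` A" if "Y \<in> XA" for Y using that by (simp add: XA_def)
        have XB: "incident G Y \<in> fst ` (D' - A)" if "Y \<in> XB" for Y using that by (simp add: XB_def)
        have "\<exists>e\<in>edges G. ends G e \<inter> S \<noteq> {} \<and> ends G e \<inter> R \<noteq> {}"
        proof (cases "S = verts G")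
          \<comment> \<open>No edge leaves \<open>S\<close> here. A trail outside \<open>A\<close>
            provides a vertex in \<open>R\<close>, which is then also in \<open>S\<close>, and any
            edge at it will do.\<close>
          case True
          obtain q where q: "q \<in> D' - A" using A by blast
          then have "fst q \<in> incident G ` fst ` D" unfolding D'(2)[symmetric] by simp
          then obtain p where p: "p \<in> D" "fst q = incident G (fst p)" by auto
          then have "fst p \<in> XB" using q unfolding XB_def by (metis (mono_tags, lifting) imageI mem_Collect_eq)
          then have pR: "fst p \<subseteq> R" unfolding R_def by blast
          obtain y where y: "y \<in> fst p" using members(2)[OF p(1)] by blast
          then have "y \<in> verts G" using members(1)[OF p(1)] by blast
          from cut_connected_edge_at[OF G con False this]
          obtain e where e: "e \<in> edges G" "y \<in> ends G e" by blast
          have "y \<in> S" "y \<in> R" using True pR y \<open>y \<in> verts G\<close> by auto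
          then show ?thesis using e by blast
        next
          case False
          moreover have "S \<subseteq> verts G" using SR by blast
          moreover have "S \<noteq> {}" using X(1) by (simp add: S_def)
          ultimately obtain e where e: "e \<in> edges G" "ends G e \<inter> S \<noteq> {}" "ends G e - S \<noteq> {}"
            using con unfolding cut_connected_def by meson
          moreover have "ends G e \<subseteq> S \<union> R" using G e(1) unfolding SR by (simp add: mgraph_def)
          ultimately show ?thesis by blast
        qed
        then obtain e where e: "e \<in> edges G" "ends G e \<inter> S \<noteq> {}" "ends G e \<inter> R \<noteq> {}" by blast
        have inc: "e \<in> incident G Y" if "ends G e \<inter> Y \<noteq> {}" for Y
          using that e(1) by (simp add: incident_def)
        have "e \<in> incident G X \<union> \<Union>(fst ` A)"
        proof (cases "ends G e \<inter> X = {}")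
          case True
          then obtain Y where "Y \<in> XA" "ends G e \<inter> Y \<noteq> {}" using e(2) unfolding S_def by blast
          then show ?thesis using XA inc by (meson UnI2 UnionI)
        qed (use inc in blast)
        moreover have "e \<in> \<Union>(fst ` (D' - A))"
        proof -
          obtain Y where "Y \<in> XB" "ends G e \<inter> Y \<noteq> {}" using e(3) unfolding R_def by blast
          then show ?thesis using XB inc by (meson UnionI)
        qed
        ultimately show ?thesis by blast
      qed
      \<comment> \<open>The merged trail spans the line graph, because every edge of
        \<open>G\<close> is incident to a covered vertex.\<close>
      then obtain a b H where "trail_sets (line_graph G) a b (incident G X \<union> \<Union>(fst ` D')) H"
        using cover_merge[OF D'(1)] by blast
      then have "trail_sets (line_graph G) a b (verts (line_graph G)) H"
        unfolding K' K incident_verts[OF G] line_graph_simps .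
      \<comment> \<open>If the line graph has edges, the second line graph is traceable by its
        spanning trail; otherwise the line graph is a single vertex.\<close>
      then have "traceable ((line_graph ^^ 2) G)" if "edges (line_graph G) \<noteq> {}"
        using traceable_line_graph[OF L(1)] that by (simp add: numeral_2_eq_2)
      moreover have "traceable ((line_graph ^^ 1) G)" if "edges (line_graph G) = {}"
        using traceable_no_edges[OF L(2) that] by simp
      ultimately have "\<exists>m \<le> 2. traceable ((line_graph ^^ m) G)"
        by (cases "edges (line_graph G) = {}") (use one_le_numeral in blast)+
      then show ?thesis by (meson trans_le_add2)
    next
      case False
      \<comment> \<open>The open trail has at least one vertex, so \<open>U\<close> is a proper
        subset and connectedness yields the edge leaving it that the count needs.\<close>
      have U: "U \<subseteq> verts G" "U \<noteq> verts G" using X UK by auto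
      have degU: "degree G u \<le> 2" if "u \<in> U" for u using less.prems(4) that unfolding U_def by blast
      \<comment> \<open>An edge is uncovered in the line graph exactly if it has no covered
        end.\<close>
      have U': "verts (line_graph G) - (incident G X \<union> \<Union>(fst ` D')) = {e \<in> edges G. ends G e \<subseteq> U}"
        unfolding K' line_graph_simps using G by (auto simp: incident_def UK mgraph_def)
      have lt: "card {e \<in> edges G. ends G e \<subseteq> U} < card U"
        by (rule card_inner_edges_less[OF G con U(1) False U(2) degU])
      have "degree (line_graph G) e \<le> 2" if "e \<in> {e \<in> edges G. ends G e \<subseteq> U}" for e
        using that by (intro degree_line_graph_le_2[OF G] degU) auto
      then have "\<exists>m \<le> card {e \<in> edges G. ends G e \<subseteq> U} + 2. traceable ((line_graph ^^ m) (line_graph G))"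
        using less.hyps[OF _ L D'(1)] lt unfolding U' U_def[symmetric] by simp
      \<comment> \<open>The strict decrease pays for the line graph step just made, hence
        \<open>Suc m\<close>.\<close>
      then obtain m where "m \<le> card {e \<in> edges G. ends G e \<subseteq> U} + 2" "traceable ((line_graph ^^ Suc m) G)"
        by (auto simp: funpow_Suc_right simp del: funpow.simps)
      then show ?thesis using lt unfolding U_def[symmetric] by (intro exI[of _ "Suc m"]) auto
    qed
  qed
qed

section \<open>Transfer to the tagged graph, and the bound\<close>

lemma mgraph_tag: "mgraph G \<Longrightarrow> mgraph (tag G)"
  by (auto simp: mgraph_def tag_def card_image inj_on_def)

lemma walk_tag: "walk G vs es \<Longrightarrow> walk (tag G) (map Vert vs) (map Edge es)"
  by (auto simp: walk_def tag_def)

lemma degree_tag: "degree (tag G) (Vert v) = degree G v"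
proof -
  have "{x \<in> edges (tag G). Vert v \<in> ends (tag G) x} = Edge ` {e \<in> edges G. v \<in> ends G e}"
    by (auto simp: tag_def)
  then show ?thesis by (simp add: degree_def card_image inj_on_def)
qed

lemma connected_tag:
  assumes "connected G"
  shows "connected (tag G)"
proof -
  have "\<exists>xs ls. walk (tag G) xs ls \<and> hd xs = Vert u \<and> last xs = Vert v"
    if "u \<in> verts G" "v \<in> verts G" for u v
  proof -
    obtain vs es where w: "walk G vs es" "hd vs = u" "last vs = v"
      using assms \<open>u \<in> verts G\<close> \<open>v \<in> verts G\<close> unfolding connected_def by blast
    then have "vs \<noteq> []" by (auto simp: walk_Nil)
    then show ?thesis using w walk_tag[OF w(1)] by (metis hd_map last_map)
  qed
  then show ?thesis using assms unfolding connected_def by (auto simp: tag_def)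
qed

text \<open>No degree exceeds \<open>max_degree G\<close>, so the upper end of the range in
  \<open>verts_ge3\<close> excludes no vertex.\<close>

lemma verts_ge3_iff:
  assumes "mgraph G" "v \<in> verts G"
  shows "v \<in> verts_ge3 G \<longleftrightarrow> 3 \<le> degree G v"
proof -
  have "degree G v \<le> max_degree G" unfolding max_degree_def using assms by (auto simp: mgraph_def)
  then show ?thesis using assms by (auto simp: verts_ge3_def verts_of_degree_def)
qed

theorem theorem15:
  fixes G :: "('v, 'e) mgraph" and n :: nat
  assumes "mgraph G" and "connected G" and "card (verts G) = n"
    and "is_MT_star G vs es"
  defines "mt_star \<equiv> card (set vs)"
    and "d_star \<equiv> card (verts_ge3 G - set vs)"
  shows "(\<exists>m. traceable (iter_line_graph m G)) \<and>
    int (ham_path_index G) \<le> int n - int mt_star - int d_star + 2"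
proof -
  have trail: "walk G vs es" "distinct es" using assms(4) by (auto simp: is_MT_star_def trail_def)
  have vs: "vs \<noteq> []" "set vs \<subseteq> verts G" using trail by (auto simp: walk_def)
  have ge3: "verts_ge3 G \<subseteq> verts G" by (auto simp: verts_ge3_def verts_of_degree_def)
  let ?G = "tag G :: (('v, 'e) obj, ('v, 'e) obj) mgraph"
  let ?W = "verts_ge3 G - set vs"
  \<comment> \<open>The trivial closed trails, one vertex and no edge each, at the vertices of
    degree at least 3 that the given trail misses.\<close>
  let ?C = "(\<lambda>v. ({Vert v :: ('v, 'e) obj}, {} :: ('v, 'e) obj set)) ` ?W"
  have "trail_sets ?G (hd (map Vert vs)) (last (map Vert vs)) (Vert ` set vs) (Edge ` set es)"
    using trail_imp_trail_sets[OF walk_tag[OF trail(1)]] trail(2) by (simp add: distinct_map inj_on_def)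
  moreover have "trail_sets ?G (Vert v) (Vert v) {Vert v} {}" if "v \<in> ?W" for v
    using that ge3 by (intro trail_sets_Nil) (auto simp: tag_def)
  \<comment> \<open>The edges incident to a single vertex are counted by its degree, so degree 3 is
    just what a closed trail in a cover requires.\<close>
  moreover have "3 \<le> card (incident ?G {Vert v})" if "v \<in> ?W" for v
  proof -
    have "card (incident ?G {Vert v}) = degree ?G (Vert v)" by (simp add: incident_def degree_def)
    then show ?thesis using that ge3 verts_ge3_iff[OF assms(1), of v] by (auto simp: degree_tag)
  qed
  moreover have "finite ?W" using assms(1) ge3 finite_subset by (auto simp: mgraph_def)
  ultimately have cov: "cover ?G (Vert ` set vs) (Edge ` set es) ?C"
    unfolding cover_def by auto
  let ?U = "verts G - set vs - verts_ge3 G"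
  have U: "verts ?G - (Vert ` set vs \<union> \<Union>(fst ` ?C)) = Vert ` ?U"
    by (auto simp: tag_def)
  have "degree ?G u \<le> 2" if "u \<in> Vert ` ?U" for u
    using that verts_ge3_iff[OF assms(1)] by (fastforce simp: degree_tag)
  then obtain m where m: "m \<le> card (Vert ` ?U :: ('v, 'e) obj set) + 2" "traceable (iter_line_graph m G)"
    using traceable_iterated_line_graph[OF mgraph_tag[OF assms(1)]
        connected_imp_cut_connected[OF connected_tag[OF assms(2)]] cov]
    unfolding U iter_line_graph_def by blast
  have "card (Vert ` ?U :: ('v, 'e) obj set) = card ?U" by (simp add: card_image inj_on_def)
  \<comment> \<open>The vertices on the trail, the missed ones of degree at least 3 and the
    uncovered ones partition \<open>verts G\<close>, so \<open>?U\<close> has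
    \<open>n - mt_star - d_star\<close> elements.\<close>
  moreover have "card (verts G) = card (set vs) + card ?W + card ?U"
  proof -
    have fin: "finite (verts G)" using assms(1) by (simp add: mgraph_def)
    have "verts G = set vs \<union> ?W \<union> ?U" using vs ge3 by auto
    also have "card \<dots> = card (set vs \<union> ?W) + card ?U"
      using fin \<open>finite ?W\<close> by (intro card_Un_disjoint) auto
    also have "card (set vs \<union> ?W) = card (set vs) + card ?W"
      using \<open>finite ?W\<close> by (intro card_Un_disjoint) auto
    finally show ?thesis .
  qed
  moreover have "ham_path_index G \<le> m" unfolding ham_path_index_def using m(2) by (rule Least_le)
  ultimately show ?thesis using m assms(3) unfolding mt_star_def d_star_def by auto
qed

end
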